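(* Let $\nu$ be an absolutely continuous probability distribution on $[-\pi,\pi]$ with continuous probability density, let ${\bf V}$ be the $N\times N$ random Vandermonde matrix with phases i.i.d. according to $\nu$, and let $\lambda_N$ be the maximum eigenvalue of ${\bf V}^*{\bf V}$. Then for any $0<\alpha<1$, $$\mathbb{P}\Big(\lambda_N\ge\frac{\alpha\log N}{\log\log N}\Big)=1-o(1)\quad\text{as }N\to\infty.$$
   Context: ${\bf V}=N^{-1/2}(e^{-j(k-1)\theta_l})_{1\le k,l\le N}$ with $\theta_1,\dots,\theta_N$ i.i.d. with law $\nu$. *)

theory Defs
  imports "HOL-Probability.Probability" "Jordan_Normal_Form.Schur_Decomposition"
begin

text \<open>Random Vandermonde matrix V = N^(-1/2) (exp(-j (k-1) theta_l))_{1<=k,l<=N},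
  with 0-based indices k,l < N (so the exponent is -j k theta_l).\<close>
definition vandermonde :: "nat \<Rightarrow> (nat \<Rightarrow> real) \<Rightarrow> complex mat" where
  "vandermonde N \<theta> = mat N N (\<lambda>(k,l). cis (- real k * \<theta> l) / complex_of_real (sqrt (real N)))"

text \<open>Maximum eigenvalue of a (Hermitian, hence real-spectrum) complex matrix.\<close>
definition max_eigenvalue :: "complex mat \<Rightarrow> real" where
  "max_eigenvalue A = Max (Re ` {z. eigenvalue A z})"

end

theory Submission
  imports Defs "Jordan_Normal_Form.Spectral_Radius" "HOL-Real_Asymp.Real_Asymp"
begin

text \<open>
  If \<open>m\<close> phases lie in an interval of length \<open>c / N\<close>, then testing the Rayleigh quotient of \<open>V\<^sup>* V\<close> with
  the indicator vector of these phases gives \<open>\<lambda>\<^sub>N \<ge> m (1 - c)\<^sup>2\<close>, because all phases \<open>k \<theta>\<^sub>l\<close> with \<open>k < N\<close>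
  then agree up to \<open>c\<close>. On an interval where the density is bounded away from \<open>0\<close> there are order \<open>N\<close>
  disjoint bins of length \<open>c / N\<close>, each of mass of order \<open>1 / N\<close>. The expected number of bins holding
  exactly \<open>m = \<lceil>\<beta> log N / log log N\<rceil>\<close> phases is \<open>N powr (1 - \<beta> + o(1))\<close>, and the second moment method
  shows that for \<open>\<beta> < 1\<close> such a bin exists with probability \<open>1 - o(1)\<close>. Given \<open>\<alpha> < 1\<close>, choose
  \<open>\<alpha> < \<beta> < 1\<close> and \<open>(1 - c)\<^sup>2 = \<alpha> / \<beta>\<close>.

  The event is measurable because \<open>\<lambda>\<^sub>N\<close> is a maximum of Rayleigh quotients, each continuous in the phases,
  and hence lower semicontinuous.
\<close>

section \<open>Maximum eigenvalue of a Gram matrix\<close>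

text \<open>This is the squared norm of \<open>a v\<close>. Vectors are functions on all of
  \<open>nat\<close>, of which only the coordinates below \<open>n\<close> count, so that the
  product topology on functions is available.\<close>

definition gram_form :: "nat \<Rightarrow> (nat \<Rightarrow> nat \<Rightarrow> complex) \<Rightarrow> (nat \<Rightarrow> complex) \<Rightarrow> real" where
  "gram_form n a v = (\<Sum>k<n. (cmod (\<Sum>l<n. a k l * v l))\<^sup>2)"

definition sq_norm_upto :: "nat \<Rightarrow> (nat \<Rightarrow> complex) \<Rightarrow> real" where
  "sq_norm_upto n v = (\<Sum>l<n. (cmod (v l))\<^sup>2)"

lemma sq_norm_upto_nonneg: "0 \<le> sq_norm_upto n v"
  unfolding sq_norm_upto_def by (intro sum_nonneg) auto

lemma sq_norm_upto_eq_0_iff: "sq_norm_upto n v = 0 \<longleftrightarrow> (\<forall>l<n. v l = 0)"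
  unfolding sq_norm_upto_def by (subst sum_nonneg_eq_0_iff) auto

lemma gram_form_scale: "gram_form n a (\<lambda>l. c * v l) = (cmod c)\<^sup>2 * gram_form n a v"
proof -
  have "(\<Sum>l<n. a k l * (c * v l)) = c * (\<Sum>l<n. a k l * v l)" for k
    by (simp add: sum_distrib_left mult_ac)
  then show ?thesis
    unfolding gram_form_def by (simp only: norm_mult power_mult_distrib) (simp add: sum_distrib_left)
qed

lemma gram_form_cong: "(\<And>l. l < n \<Longrightarrow> v l = w l) \<Longrightarrow> gram_form n a v = gram_form n a w"
  unfolding gram_form_def by (intro sum.cong refl arg_cong[where f = "\<lambda>x. (cmod x)\<^sup>2"]) auto

lemma sq_norm_upto_cong: "(\<And>l. l < n \<Longrightarrow> v l = w l) \<Longrightarrow> sq_norm_upto n v = sq_norm_upto n w"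
  unfolding sq_norm_upto_def by (intro sum.cong) auto

lemma sq_norm_upto_scale: "sq_norm_upto n (\<lambda>l. c * v l) = (cmod c)\<^sup>2 * sq_norm_upto n v"
  unfolding sq_norm_upto_def by (simp add: norm_mult power_mult_distrib sum_distrib_left)

lemma continuous_on_coordinate: "continuous_on S (\<lambda>x. x i :: 'b::topological_space)"
  by (rule continuous_on_subset[OF continuous_on_product_coordinates]) auto

text \<open>Compactness of the unit sphere gives a maximiser, and homogeneity extends the bound from
  the sphere to every \<open>v\<close>. The maximiser itself is kept, since it will turn out to be
  an eigenvector.\<close>

lemma gram_form_attains_max:
  assumes "n > 0"
  obtains u where "sq_norm_upto n u = 1"
    and "\<And>v. gram_form n a v \<le> gram_form n a u * sq_norm_upto n v"
proof -
  \<comment> \<open>The coordinates from \<open>n\<close> on are pinned to 0; left free, they would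
    make the set of unit vectors noncompact. Tychonoff then applies.\<close>
  define K :: "(nat \<Rightarrow> complex) set"
    where "K = (\<Pi>\<^sub>E i\<in>UNIV. if i < n then cball 0 1 else {0})"
  define S where "S = K \<inter> {v. sq_norm_upto n v = 1}"
  have "compact K"
    using compactin_PiE[of "\<lambda>_::nat. euclidean :: complex topology" UNIV
        "\<lambda>i. if i < n then cball 0 1 else {0}"]
    by (simp add: K_def euclidean_product_topology)
  moreover have cont: "continuous_on UNIV (sq_norm_upto n)" "continuous_on UNIV (gram_form n a)"
    unfolding sq_norm_upto_def gram_form_def
    by (intro continuous_intros continuous_on_coordinate)+
  moreover have "closed {v. sq_norm_upto n v = 1}"
    using cont(1) by (intro closed_Collect_eq continuous_intros)
  ultimately have "compact S" "continuous_on S (gram_form n a)"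
    unfolding S_def by (auto intro: compact_Int_closed continuous_on_subset)
  moreover have "S \<noteq> {}"
  proof -
    have "(\<lambda>i. if i = 0 then 1 else 0) \<in> S"
      using assms by (auto simp: S_def K_def PiE_iff sq_norm_upto_def if_distrib[of "\<lambda>x. (cmod x)\<^sup>2"]
          cong: if_cong)
    then show ?thesis by blast
  qed
  ultimately obtain u where u: "u \<in> S" "\<And>v. v \<in> S \<Longrightarrow> gram_form n a v \<le> gram_form n a u"
    using continuous_attains_sup[of S "gram_form n a"] by blast
  have "gram_form n a v \<le> gram_form n a u * sq_norm_upto n v" for v
  proof (cases "sq_norm_upto n v = 0")
    case True
    then have "gram_form n a v = 0"
      by (simp add: sq_norm_upto_eq_0_iff gram_form_def)
    then show ?thesis using True by simp
  next
    case False
    then have pos: "sq_norm_upto n v > 0"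
      using sq_norm_upto_nonneg[of n v] by linarith
    define c where "c = complex_of_real (1 / sqrt (sq_norm_upto n v))"
    have c2: "(cmod c)\<^sup>2 = 1 / sq_norm_upto n v"
      using pos by (simp add: c_def norm_divide power_divide)
    \<comment> \<open>Besides normalising, \<open>w\<close> is cut off to 0 beyond \<open>n\<close>
      in order to lie in \<open>K\<close>; neither form sees these coordinates.\<close>
    define w where "w l = (if l < n then c * v l else 0)" for l
    have w: "gram_form n a w = gram_form n a v / sq_norm_upto n v" "sq_norm_upto n w = 1"
      using gram_form_cong[of n w "\<lambda>l. c * v l" a] sq_norm_upto_cong[of n w "\<lambda>l. c * v l"] pos
      by (auto simp: w_def gram_form_scale sq_norm_upto_scale c2)
    have "cmod (w i) \<le> 1" if "i < n" for i
    proof -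
      have "(cmod (w i))\<^sup>2 \<le> sq_norm_upto n w"
        unfolding sq_norm_upto_def using that by (intro member_le_sum) auto
      then show ?thesis using w by (simp add: power2_le_iff_abs_le abs_square_le_1)
    qed
    then have "w \<in> S" using w by (auto simp: S_def K_def PiE_iff w_def)
    from u(2)[OF this] w pos show ?thesis by (simp add: field_simps)
  qed
  with u show thesis by (intro that[of u]) (auto simp: S_def)
qed

section \<open>The maximiser satisfies the eigenvector equation\<close>

lemma inner_complex_mult_right: "inner x (c * y) = inner (cnj c * x) (y::complex)"
  by (simp add: inner_complex_def algebra_simps)

text \<open>Coordinate \<open>l\<close> of \<open>a^H a v\<close>, where \<open>a^H\<close> is the
  conjugate transpose.\<close>

definition gram_apply :: "nat \<Rightarrow> (nat \<Rightarrow> nat \<Rightarrow> complex) \<Rightarrow> (nat \<Rightarrow> complex) \<Rightarrow> nat \<Rightarrow> complex" where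
  "gram_apply n a v l = (\<Sum>k<n. cnj (a k l) * (\<Sum>j<n. a k j * v j))"

lemma gram_adjoint:
  "(\<Sum>k<n. inner (\<Sum>l<n. a k l * v l) (\<Sum>l<n. a k l * w l)) = (\<Sum>l<n. inner (gram_apply n a v l) (w l))"
proof -
  have "(\<Sum>k<n. inner (\<Sum>l<n. a k l * v l) (\<Sum>l<n. a k l * w l))
      = (\<Sum>k<n. \<Sum>l<n. inner (cnj (a k l) * (\<Sum>j<n. a k j * v j)) (w l))"
    by (simp add: inner_sum_right inner_complex_mult_right)
  also have "\<dots> = (\<Sum>l<n. inner (gram_apply n a v l) (w l))"
    by (subst sum.swap) (simp add: gram_apply_def inner_sum_left)
  finally show ?thesis .
qed

lemma gram_form_eq_inner: "gram_form n a v = (\<Sum>l<n. inner (gram_apply n a v l) (v l))"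
  using gram_adjoint[where v = v and w = v] by (simp add: gram_form_def power2_norm_eq_inner)

text \<open>The quadratic vanishes at 0 and is nonnegative, so 0 is a minimum and the derivative
  there is zero.\<close>

lemma quadratic_nonneg_imp_linear_zero:
  fixes c d :: real
  assumes "\<And>t. 0 \<le> 2 * t * c + t\<^sup>2 * d"
  shows "c = 0"
proof (rule ccontr)
  assume "c \<noteq> 0"
  \<comment> \<open>Any positive \<open>e\<close> with \<open>d < 2 * e\<close> would do: at
    \<open>t = - c / e\<close> the quadratic is \<open>(c / e)^2 * (d - 2 * e)\<close>, which is
    negative unless \<open>c = 0\<close>.\<close>
  define e where "e = \<bar>d\<bar> + 1"
  have e: "e > 0" "d < e" by (auto simp: e_def)
  have "0 \<le> 2 * (- c / e) * c + (- c / e)\<^sup>2 * d" by (rule assms)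
  also have "\<dots> = (c / e)\<^sup>2 * (d - 2 * e)"
    using e by (simp add: field_simps power2_eq_square)
  finally have "0 \<le> d - 2 * e"
    using \<open>c \<noteq> 0\<close> e by (simp add: zero_le_mult_iff)
  then show False using e by simp
qed

text \<open>First-order optimality of the maximiser, tested in the direction of the residual.\<close>
lemma gram_maximizer_eigen:
  assumes u: "sq_norm_upto n u = 1"
    and max: "\<And>v. gram_form n a v \<le> gram_form n a u * sq_norm_upto n v"
    and "l < n"
  shows "gram_apply n a u l = complex_of_real (gram_form n a u) * u l"
proof -
  define M where "M = gram_form n a u"
  define r where "r l = of_real M * u l - gram_apply n a u l" for l
  define L where "L v k = (\<Sum>l<n. a k l * v l)" for v k
  have gram_L: "gram_form n a v = (\<Sum>k<n. (cmod (L v k))\<^sup>2)" for v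
    by (simp add: gram_form_def L_def)
  have L_add: "L (\<lambda>l. u l + t *\<^sub>R w l) k = L u k + t *\<^sub>R L w k" for t w k
    by (simp add: L_def algebra_simps sum.distrib scaleR_sum_right)
  \<comment> \<open>Maximality at \<open>u + t r\<close> is expanded in powers of \<open>t\<close>.
    The constant terms cancel because \<open>u\<close> has norm 1, and the linear coefficient is
    twice the squared norm of the residual \<open>r\<close>.\<close>
  have "0 \<le> 2 * t * (\<Sum>l<n. (cmod (r l))\<^sup>2) + t\<^sup>2 * (M * sq_norm_upto n r - gram_form n a r)" for t
  proof -
    have sq: "(cmod (x + t *\<^sub>R y))\<^sup>2 = (cmod x)\<^sup>2 + 2 * t * inner x y + t\<^sup>2 * (cmod y)\<^sup>2" for x y
      unfolding power2_norm_eq_inner inner_add_left inner_add_right inner_commute[of y x]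
      by (simp add: power2_eq_square algebra_simps inner_commute[of y x])
    have 1: "gram_form n a (\<lambda>l. u l + t *\<^sub>R r l)
        = M + 2 * t * (\<Sum>k<n. inner (L u k) (L r k)) + t\<^sup>2 * gram_form n a r"
      unfolding gram_L M_def L_add sq by (simp add: sum.distrib sum_distrib_left)
    have 2: "sq_norm_upto n (\<lambda>l. u l + t *\<^sub>R r l)
        = 1 + 2 * t * (\<Sum>l<n. inner (u l) (r l)) + t\<^sup>2 * sq_norm_upto n r"
      unfolding u[symmetric] unfolding sq_norm_upto_def sq by (simp add: sum.distrib sum_distrib_left)
    have 3: "(\<Sum>k<n. inner (L u k) (L r k)) = (\<Sum>l<n. inner (gram_apply n a u l) (r l))"
      unfolding L_def by (rule gram_adjoint)
    have 4: "M * (\<Sum>l<n. inner (u l) (r l)) - (\<Sum>l<n. inner (gram_apply n a u l) (r l))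
        = (\<Sum>l<n. (cmod (r l))\<^sup>2)"
      by (simp add: sum_distrib_left power2_norm_eq_inner inner_mult_left[symmetric]
          flip: sum_subtractf inner_diff_left) (simp add: r_def)
    show ?thesis
      using max[of "\<lambda>l. u l + t *\<^sub>R r l"] unfolding 1 2 3 4[symmetric] M_def[symmetric]
      by (simp add: algebra_simps)
  qed
  then have "(\<Sum>l<n. (cmod (r l))\<^sup>2) = 0" by (rule quadratic_nonneg_imp_linear_zero)
  then have "r l = 0" using \<open>l < n\<close> by (subst (asm) sum_nonneg_eq_0_iff) auto
  then show ?thesis by (simp add: r_def M_def)
qed

section \<open>Rayleigh quotients and matrix eigenvalues\<close>

lemma gram_mult_vec:
  fixes B :: "complex mat"
  assumes B: "B \<in> carrier_mat n n"
  shows "mat_adjoint B * B *\<^sub>v vec n v = vec n (gram_apply n (\<lambda>k l. B $$ (k, l)) v)"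
proof -
  have adj: "mat_adjoint B \<in> carrier_mat n n"
    using B unfolding mat_adjoint_def by auto
  have adj_entry: "mat_adjoint B $$ (l, k) = cnj (B $$ (k, l))" if "l < n" "k < n" for l k
    using B that unfolding mat_adjoint_def by (auto simp: mat_of_rows_def)
  have "mat_adjoint B * B *\<^sub>v vec n v = mat_adjoint B *\<^sub>v (B *\<^sub>v vec n v)"
    using adj B by (intro assoc_mult_mat_vec) auto
  also have "\<dots> = vec n (gram_apply n (\<lambda>k l. B $$ (k, l)) v)"
    using B adj by (intro eq_vecI) (auto simp: scalar_prod_def gram_apply_def adj_entry lessThan_atLeast0
      intro!: sum.cong)
  finally show ?thesis .
qed

text \<open>Rayleigh-Ritz: the maximiser of the form is an eigenvector whose eigenvalue is the
  maximum, and no eigenvalue can have a larger real part. The two conclusions together identify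
  \<open>\<mu>\<close> as the maximal Rayleigh quotient.\<close>

lemma max_eigenvalue_gram:
  fixes B :: "complex mat"
  assumes B: "B \<in> carrier_mat n n" and "n > 0"
  defines "a \<equiv> \<lambda>k l. B $$ (k, l)"
  defines "\<mu> \<equiv> max_eigenvalue (mat_adjoint B * B)"
  shows "gram_form n a v \<le> \<mu> * sq_norm_upto n v"
    and "\<exists>u. sq_norm_upto n u = 1 \<and> gram_form n a u = \<mu>"
proof -
  let ?A = "mat_adjoint B * B"
  have A: "?A \<in> carrier_mat n n"
    using B unfolding mat_adjoint_def by auto
  obtain u where u: "sq_norm_upto n u = 1"
    and max: "\<And>v. gram_form n a v \<le> gram_form n a u * sq_norm_upto n v"
    using gram_form_attains_max[OF \<open>n > 0\<close>] by metis
  have "finite {z. eigenvalue ?A z}"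
    using card_finite_spectrum(1)[OF A] by (simp add: spectrum_def)
  moreover have "eigenvalue ?A (of_real (gram_form n a u))"
  proof -
    have "?A *\<^sub>v vec n u = of_real (gram_form n a u) \<cdot>\<^sub>v vec n u"
      unfolding gram_mult_vec[OF B] a_def[symmetric]
      by (intro eq_vecI) (auto simp: gram_maximizer_eigen[OF u max])
    moreover have "vec n u \<noteq> 0\<^sub>v n"
    proof
      assume *: "vec n u = 0\<^sub>v n"
      have "u l = 0" if "l < n" for l
        using arg_cong[OF *, of "\<lambda>x. x $ l"] that by simp
      then have "sq_norm_upto n u = 0" by (simp add: sq_norm_upto_eq_0_iff)
      with u show False by simp
    qed
    ultimately show ?thesis
      using A unfolding eigenvalue_def eigenvector_def by (intro exI[of _ "vec n u"]) auto
  qed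
  \<comment> \<open>Pairing the eigenvector equation with the eigenvector shows that
    \<open>Re z\<close> is its Rayleigh quotient.\<close>
  moreover have "Re z \<le> gram_form n a u" if z: "eigenvalue ?A z" for z
  proof -
    obtain x where x: "x \<in> carrier_vec n" "x \<noteq> 0\<^sub>v n" "?A *\<^sub>v x = z \<cdot>\<^sub>v x"
      using z A unfolding eigenvalue_def eigenvector_def by auto
    define w where "w l = x $ l" for l
    have xw: "x = vec n w" using x(1) by (intro eq_vecI) (auto simp: w_def)
    have ev: "gram_apply n a w l = z * w l" if "l < n" for l
      using arg_cong[OF x(3), of "\<lambda>x. x $ l"] that unfolding xw gram_mult_vec[OF B] a_def[symmetric]
      by simp
    have "gram_form n a w = Re z * sq_norm_upto n w"
      unfolding gram_form_eq_inner sq_norm_upto_def sum_distrib_left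
      by (intro sum.cong refl) (simp add: ev inner_complex_def cmod_power2, simp add: power2_eq_square algebra_simps)
    moreover have "sq_norm_upto n w \<noteq> 0"
      using x(2) unfolding sq_norm_upto_eq_0_iff xw by (auto intro: eq_vecI)
    ultimately show ?thesis
      using max[of w] sq_norm_upto_nonneg[of n w] by simp
  qed
  ultimately have "\<mu> = gram_form n a u"
    unfolding \<mu>_def max_eigenvalue_def by (intro Max_eqI) (auto simp: image_iff intro!: exI[of _ "of_real (gram_form n a u)"])
  with u max show "gram_form n a v \<le> \<mu> * sq_norm_upto n v"
    and "\<exists>u. sq_norm_upto n u = 1 \<and> gram_form n a u = \<mu>" by auto
qed

section \<open>Occupancy of bins\<close>

text \<open>Chebyshev's inequality for the number \<open>f\<close> of events that occur. The
  constant \<open>C\<close> measures how far distinct events are from being uncorrelated; with mean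
  \<open>m\<close> the variance is at most \<open>m + (C - 1) * m^2\<close>.\<close>

lemma (in prob_space) prob_Union_second_moment:
  assumes fin: "finite I" and ev: "\<And>x. x \<in> I \<Longrightarrow> A x \<in> events"
    and pair: "\<And>x y. x \<in> I \<Longrightarrow> y \<in> I \<Longrightarrow> x \<noteq> y \<Longrightarrow> prob (A x \<inter> A y) \<le> C * (prob (A x) * prob (A y))"
    and "C \<ge> 0" and \<mu>: "0 < \<mu>" "\<mu> \<le> (\<Sum>x\<in>I. prob (A x))"
  shows "1 - (1 / \<mu> + (C - 1)) \<le> prob (\<Union>x\<in>I. A x)"
proof -
  define f where "f \<omega> = (\<Sum>x\<in>I. indicat_real (A x) \<omega>)" for \<omega>
  define m where "m = (\<Sum>x\<in>I. prob (A x))"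
  have m: "m > 0" "\<mu> \<le> m" using \<mu> by (auto simp: m_def)
  have [measurable]: "f \<in> borel_measurable M"
    unfolding f_def using ev by (intro borel_measurable_sum borel_measurable_indicator) auto
  have Ef: "expectation f = m"
    unfolding f_def m_def using ev by (subst Bochner_Integration.integral_sum) (auto simp: less_top[symmetric] emeasure_finite)
  have f2: "(f \<omega>)\<^sup>2 = (\<Sum>x\<in>I. \<Sum>y\<in>I. indicat_real (A x \<inter> A y) \<omega>)" for \<omega>
    unfolding f_def power2_eq_square sum_product by (simp add: indicator_inter_arith)
  have int: "integrable M (\<lambda>\<omega>. indicat_real (A x \<inter> A y) \<omega>)" if "x \<in> I" "y \<in> I" for x y
    using ev that by (auto simp: less_top[symmetric] emeasure_finite)
  have intf2: "integrable M (\<lambda>\<omega>. (f \<omega>)\<^sup>2)"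
    unfolding f2 using int by (intro Bochner_Integration.integrable_sum) auto
  have intf: "integrable M f"
    by (rule square_integrable_imp_integrable[OF _ intf2]) auto
  have "expectation (\<lambda>\<omega>. (f \<omega>)\<^sup>2) = (\<Sum>x\<in>I. \<Sum>y\<in>I. expectation (indicat_real (A x \<inter> A y)))"
    unfolding f2 using int
    by (subst Bochner_Integration.integral_sum, force intro!: Bochner_Integration.integrable_sum)
      (intro sum.cong refl Bochner_Integration.integral_sum, auto)
  also have "\<dots> = (\<Sum>x\<in>I. \<Sum>y\<in>I. prob (A x \<inter> A y))"
    using ev by (intro sum.cong refl) (auto simp: Int_absorb2 sets.sets_into_space intro!: arg_cong[where f = prob])
  \<comment> \<open>The diagonal pairs contribute \<open>prob (A x)\<close>. Adding the
    \<open>C\<close> term to them as well only enlarges the bound and makes the double sum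
    factor.\<close>
  also have "\<dots> \<le> (\<Sum>x\<in>I. \<Sum>y\<in>I. (if y = x then prob (A x) else 0) + C * (prob (A x) * prob (A y)))"
    using pair \<open>C \<ge> 0\<close> by (intro sum_mono) (auto simp: add_increasing2)
  also have "\<dots> = m + C * m\<^sup>2"
    using fin by (simp add: sum.distrib m_def power2_eq_square sum_product flip: sum_distrib_left)
  finally have var: "variance f \<le> m + C * m\<^sup>2 - m\<^sup>2"
    using variance_eq[OF intf intf2] Ef by simp
  have "1 - prob (\<Union>x\<in>I. A x) = prob (space M - (\<Union>x\<in>I. A x))"
    using ev fin by (subst prob_compl) auto
  \<comment> \<open>Where no event occurs, \<open>f\<close> is 0 and so deviates from its mean by
    \<open>m\<close>.\<close>
  also have "\<dots> \<le> prob {\<omega>\<in>space M. \<bar>f \<omega> - expectation f\<bar> \<ge> m}"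
    by (intro finite_measure_mono) (use m in \<open>auto simp: Ef\<close>, simp add: f_def)
  also have "\<dots> \<le> variance f / m\<^sup>2"
    using intf2 m by (intro Chebyshev_inequality) auto
  also have "\<dots> \<le> (m + C * m\<^sup>2 - m\<^sup>2) / m\<^sup>2"
    by (intro divide_right_mono var) auto
  also have "\<dots> = 1 / m + (C - 1)"
    using m by (simp add: field_simps power2_eq_square)
  also have "\<dots> \<le> 1 / \<mu> + (C - 1)"
    using m \<mu> by (simp add: frac_le)
  finally show ?thesis by simp
qed

lemma prod_if_mem_subset:
  fixes x y :: "'a :: comm_monoid_mult"
  assumes "finite A" "S \<subseteq> A"
  shows "(\<Prod>l\<in>A. if l \<in> S then x else y) = x ^ card S * y ^ (card A - card S)"
proof -
  have "A \<inter> S = S" "A \<inter> - S = A - S" using assms by auto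
  then show ?thesis
    using assms by (simp add: prod.If_cases card_Diff_subset finite_subset)
qed

text \<open>The second moment is taken over pairs (bin, \<open>m\<close>-subset of the points that is exactly the
  content of that bin): distinct such events are either disjoint or nearly uncorrelated.\<close>
lemma (in prob_space) exists_full_bin:
  fixes B :: "nat \<Rightarrow> 'a set" and N m K :: nat and q Q :: real
  assumes B: "\<And>i. i < K \<Longrightarrow> B i \<in> events" and disj: "disjoint_family_on B {..<K}"
    and q: "0 < q" "\<And>i. i < K \<Longrightarrow> q \<le> prob (B i)"
    and Q: "Q < 1" "\<And>i. i < K \<Longrightarrow> prob (B i) \<le> Q"
    and "0 < K" "m \<le> N"
  defines "P \<equiv> PiM {..<N} (\<lambda>_. M)"
  shows "\<exists>E\<in>sets P. (\<forall>\<theta>\<in>E. \<exists>i<K. \<exists>S\<subseteq>{..<N}. card S = m \<and> (\<forall>l\<in>S. \<theta> l \<in> B i)) \<and>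
    1 - (1 / (real K * real (N choose m) * q ^ m * (1 - Q) ^ N) + ((1 / (1 - Q)) ^ (2 * m) - 1)) \<le> measure P E"
proof -
  interpret P: product_prob_space "\<lambda>_. M" "{..<N}" by unfold_locales
  interpret P: finite_product_prob_space "\<lambda>_. M" "{..<N}" by unfold_locales auto
  \<comment> \<open>Points outside \<open>S\<close> are forced out of the bin, so
    \<open>A (i, S)\<close> says that \<open>S\<close> is the exact content of bin \<open>i\<close>.
    This makes different contents of one bin mutually exclusive.\<close>
  define X where "X i S l = (if l \<in> S then B i else space M - B i)" for i S and l :: nat
  define A where "A = (\<lambda>(i, S). PiE {..<N} (X i S))"
  define I where "I = {..<K} \<times> {S. S \<subseteq> {..<N} \<and> card S = m}"
  define b where "b i = prob (B i)" for i
  \<comment> \<open>Each bin has mass at most \<open>Q\<close>, so \<open>r\<close> bounds the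
    inverse of every factor \<open>1 - b j\<close>.\<close>
  define r where "r = 1 / (1 - Q)"
  have r: "r \<ge> 1" using Q(1) q Q(2)[OF \<open>0 < K\<close>] q(2)[OF \<open>0 < K\<close>] by (auto simp: r_def)
  have Q0: "0 < Q" using Q(1) q Q(2)[OF \<open>0 < K\<close>] q(2)[OF \<open>0 < K\<close>] by auto
  have Xs: "X i S l \<in> events" if "i < K" for i S l
    using B[OF that] by (auto simp: X_def)
  have pX: "prob (X i S l) = (if l \<in> S then b i else 1 - b i)" if "i < K" for i S l
    using B[OF that] by (auto simp: X_def b_def prob_compl)
  have pA: "measure P (A (i, S)) = b i ^ m * (1 - b i) ^ (N - m)"
    if "i < K" "S \<subseteq> {..<N}" "card S = m" for i S
  proof -
    have "measure P (A (i, S)) = (\<Prod>l<N. prob (X i S l))"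
      unfolding A_def P_def prod.case using Xs that by (intro P.finite_measure_PiM_emb) auto
    also have "\<dots> = b i ^ m * (1 - b i) ^ (N - m)"
      using that by (simp add: pX prod_if_mem_subset)
    finally show ?thesis .
  qed
  have finI: "finite I" unfolding I_def by (auto intro!: finite_subset[of _ "Pow {..<N}"])
  have Aev: "A x \<in> sets P" if "x \<in> I" for x
    using that Xs unfolding A_def P_def I_def by (auto intro!: sets_PiM_I_finite)
  have pAA: "measure P (A (i, S) \<inter> A (j, T)) = (\<Prod>l<N. prob (X i S l \<inter> X j T l))" 
    if "i < K" "j < K" for i j S T
  proof -
    have "A (i, S) \<inter> A (j, T) = PiE {..<N} (\<lambda>l. X i S l \<inter> X j T l)"
      by (auto simp: A_def PiE_iff)
    then show ?thesis
      unfolding P_def using Xs that by (auto intro!: P.finite_measure_PiM_emb)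
  qed
  have pair: "measure P (A x \<inter> A y) \<le> r ^ (2 * m) * (measure P (A x) * measure P (A y))"
    if xy: "x \<in> I" "y \<in> I" "x \<noteq> y" for x y
  proof -
    obtain i S where x: "x = (i, S)" by force
    obtain j T where y: "y = (j, T)" by force
    have S: "i < K" "S \<subseteq> {..<N}" "card S = m" and T: "j < K" "T \<subseteq> {..<N}" "card T = m"
      using xy by (auto simp: I_def x y)
    show ?thesis
    proof (cases "i = j")
      case True
      then have "S \<noteq> T" using xy x y by auto
      then obtain l where l: "l < N" "l \<in> S \<longleftrightarrow> l \<notin> T" using S T by blast
      then have "X i S l \<inter> X j T l = {}" using True by (auto simp: X_def)
      then have "(\<Prod>l<N. prob (X i S l \<inter> X j T l)) = 0"
        using l by (auto intro!: prod_zero bexI[of _ l])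
      then show ?thesis using r unfolding x y pAA[OF S(1) T(1)] by (simp only:) simp
    next
      case False
      have Bij: "B i \<inter> B j = {}" 
        using disj False S T by (auto simp: disjoint_family_on_def)
      have bi: "0 < b i" "b i \<le> Q" "0 < b j" "b j \<le> Q"
        using q(1) q(2)[OF S(1)] q(2)[OF T(1)] Q(2)[OF S(1)] Q(2)[OF T(1)] by (auto simp: b_def)
      have one: "1 \<le> (1 - c) * r" if "c \<le> Q" for c
        using that Q(1) by (simp add: r_def)
      \<comment> \<open>For distinct bins only the points in \<open>S \<union> T\<close>, at most
        \<open>2 * m\<close> of them, cost a factor \<open>r\<close>: a point of \<open>S\<close>
        alone contributes at most \<open>b i\<close> jointly, against \<open>b i * (1 - b j)\<close>
        in the product. For the remaining points,
        \<open>1 - b i - b j \<le> (1 - b i) * (1 - b j)\<close>.\<close>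
      have factor: "prob (X i S l \<inter> X j T l)
          \<le> prob (X i S l) * prob (X j T l) * (if l \<in> S \<union> T then r else 1)" for l
      proof -
        consider "l \<in> S" "l \<in> T" | "l \<in> S" "l \<notin> T" | "l \<notin> S" "l \<in> T" | "l \<notin> S" "l \<notin> T" by blast
        then show ?thesis
        proof cases
          case 1
          then show ?thesis using r Bij by (simp add: X_def)
        next
          case 2
          then have "prob (X i S l \<inter> X j T l) \<le> b i"
            using B S T by (auto simp: X_def b_def intro!: finite_measure_mono)
          also have "\<dots> \<le> b i * ((1 - b j) * r)" using one[of "b j"] bi by simp
          finally show ?thesis using 2 by (simp add: pX S T mult.assoc)
        next
          case 3
          then have "prob (X i S l \<inter> X j T l) \<le> b j"
            using B S T by (auto simp: X_def b_def intro!: finite_measure_mono)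
          also have "\<dots> \<le> b j * ((1 - b i) * r)" using one[of "b i"] bi by simp
          finally show ?thesis using 3 by (simp add: pX S T mult_ac)
        next
          case 4
          then have "X i S l \<inter> X j T l = space M - (B i \<union> B j)" by (auto simp: X_def)
          then have "prob (X i S l \<inter> X j T l) = 1 - (b i + b j)"
            using B S T Bij by (simp add: prob_compl finite_measure_Union b_def)
          also have "\<dots> \<le> (1 - b i) * (1 - b j)" using bi by (simp add: algebra_simps)
          finally show ?thesis using 4 by (simp add: pX S T)
        qed
      qed
      have "card (S \<union> T) \<le> 2 * m" using card_Un_le[of S T] S T by simp
      have "measure P (A x \<inter> A y) \<le> (\<Prod>l<N. prob (X i S l) * prob (X j T l) * (if l \<in> S \<union> T then r else 1))"
        unfolding x y pAA[OF S(1) T(1)] by (intro prod_mono conjI factor) auto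
      also have "\<dots> = measure P (A x) * measure P (A y) * r ^ card (S \<union> T)"
        unfolding x y pA[OF S] pA[OF T] prod.distrib
        using S T by (subst prod_if_mem_subset) (auto simp: pX prod_if_mem_subset)
      also have "\<dots> \<le> measure P (A x) * measure P (A y) * r ^ (2 * m)"
        using r \<open>card (S \<union> T) \<le> 2 * m\<close> by (intro mult_left_mono power_increasing) auto
      finally show ?thesis by (simp add: mult_ac)
    qed
  qed
  \<comment> \<open>A lower bound for the expected number of pairs that occur. The exponent
    \<open>N\<close> replaces \<open>N - m\<close>, which only decreases the value.\<close>
  define \<mu> where "\<mu> = real K * real (N choose m) * q ^ m * (1 - Q) ^ N"
  have "\<mu> > 0" using q Q(1) \<open>0 < K\<close> \<open>m \<le> N\<close> by (simp add: \<mu>_def)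
  have "\<mu> = (\<Sum>x\<in>I. q ^ m * (1 - Q) ^ N)"
    by (simp add: \<mu>_def I_def card_cartesian_product n_subsets)
  also have "\<dots> \<le> (\<Sum>x\<in>I. measure P (A x))"
  proof (intro sum_mono)
    fix x assume "x \<in> I"
    then obtain i S where x: "x = (i, S)" "i < K" "S \<subseteq> {..<N}" "card S = m" by (auto simp: I_def)
    have "(1 - Q) ^ N \<le> (1 - Q) ^ (N - m)"
      using Q(1) Q0 by (intro power_decreasing) auto
    also have "\<dots> \<le> (1 - b i) ^ (N - m)"
      using Q(1) Q(2)[OF x(2)] by (intro power_mono) (auto simp: b_def)
    finally show "q ^ m * (1 - Q) ^ N \<le> measure P (A x)"
      unfolding x(1) pA[OF x(2-4)] using q(1) q(2)[OF x(2)] Q(1)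
      by (intro mult_mono power_mono) (auto simp: b_def)
  qed
  finally have \<mu>_le: "\<mu> \<le> (\<Sum>x\<in>I. measure P (A x))" .
  have "prob_space P" unfolding P_def by (rule P.prob_space_axioms)
  then have "1 - (1 / \<mu> + (r ^ (2 * m) - 1)) \<le> measure P (\<Union>x\<in>I. A x)"
    using finI Aev pair r \<open>\<mu> > 0\<close> \<mu>_le
    by (intro prob_space.prob_Union_second_moment) auto
  moreover have "(\<Union>x\<in>I. A x) \<in> sets P" using finI Aev by auto
  moreover have "\<exists>i<K. \<exists>S\<subseteq>{..<N}. card S = m \<and> (\<forall>l\<in>S. \<theta> l \<in> B i)" if \<theta>: "\<theta> \<in> (\<Union>x\<in>I. A x)" for \<theta>
  proof -
    obtain i S where "i < K" "S \<subseteq> {..<N}" "card S = m" "\<theta> \<in> PiE {..<N} (X i S)"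
      using \<theta> unfolding I_def A_def by blast
    moreover then have "\<forall>l\<in>S. \<theta> l \<in> B i" 
      by (auto simp: PiE_iff X_def dest!: bspec split: if_splits)
    ultimately show ?thesis by blast
  qed
  ultimately show ?thesis unfolding \<mu>_def r_def by blast
qed

section \<open>Vandermonde matrices\<close>

abbreviation (input) vandermonde_gram :: "nat \<Rightarrow> (nat \<Rightarrow> real) \<Rightarrow> complex mat" where
  "vandermonde_gram N \<theta> \<equiv> mat_adjoint (vandermonde N \<theta>) * vandermonde N \<theta>"

lemma vandermonde_carrier: "vandermonde N \<theta> \<in> carrier_mat N N"
  by (simp add: vandermonde_def)

lemma gram_form_vandermonde:
  "gram_form N (\<lambda>k l. vandermonde N \<theta> $$ (k, l)) v
    = (\<Sum>k<N. (cmod (\<Sum>l<N. cis (- real k * \<theta> l) / complex_of_real (sqrt (real N)) * v l))\<^sup>2)"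
  unfolding gram_form_def vandermonde_def by simp

section \<open>Measurability in the phases\<close>

text \<open>A strict lower bound is witnessed by a single unit vector, and its Rayleigh quotient is
  continuous in the phases; the set is thus a union of open sets.\<close>

lemma open_max_eigenvalue_vandermonde_gt:
  assumes "N > 0"
  shows "open {\<theta>. s < max_eigenvalue (vandermonde_gram N \<theta>)}"
proof -
  let ?g = "\<lambda>\<theta>. gram_form N (\<lambda>k l. vandermonde N \<theta> $$ (k, l))"
  have "{\<theta>. s < max_eigenvalue (vandermonde_gram N \<theta>)}
      = (\<Union>u\<in>{u. sq_norm_upto N u = 1}. {\<theta>. s < ?g \<theta> u})"
  proof (intro Set.set_eqI iffI)
    fix \<theta> assume "\<theta> \<in> {\<theta>. s < max_eigenvalue (vandermonde_gram N \<theta>)}"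
    then show "\<theta> \<in> (\<Union>u\<in>{u. sq_norm_upto N u = 1}. {\<theta>. s < ?g \<theta> u})"
      using max_eigenvalue_gram(2)[OF vandermonde_carrier[of N \<theta>] assms] by auto
  next
    fix \<theta> assume "\<theta> \<in> (\<Union>u\<in>{u. sq_norm_upto N u = 1}. {\<theta>. s < ?g \<theta> u})"
    then obtain u where u: "sq_norm_upto N u = 1" "s < ?g \<theta> u" by auto
    then show "\<theta> \<in> {\<theta>. s < max_eigenvalue (vandermonde_gram N \<theta>)}"
      using max_eigenvalue_gram(1)[OF vandermonde_carrier[of N \<theta>] assms, of u] by simp
  qed
  moreover have "open {\<theta>. s < ?g \<theta> u}" for u
    unfolding gram_form_vandermonde cis_conv_exp
    by (intro open_Collect_less continuous_intros continuous_on_coordinate) (use assms in auto)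
  ultimately show ?thesis by auto
qed

lemma borel_measurable_max_eigenvalue_vandermonde:
  assumes "N > 0" and sets: "sets M = sets borel"
  shows "(\<lambda>\<theta>. max_eigenvalue (vandermonde_gram N \<theta>)) \<in> borel_measurable (PiM {..<N} (\<lambda>_. M))"
proof -
  let ?g = "\<lambda>\<theta>. max_eigenvalue (vandermonde_gram N \<theta>)"
  \<comment> \<open>Extending by 0 beyond \<open>N\<close> maps the finite product measurably into
    the Borel space of all functions, where openness is available; the matrix reads only the
    coordinates below \<open>N\<close>.\<close>
  let ?t = "\<lambda>\<theta> i. if i < N then \<theta> i else (0 :: real)"
  have "?g \<in> borel_measurable borel"
    unfolding borel_measurable_iff_greater
    using open_max_eigenvalue_vandermonde_gt[OF \<open>N > 0\<close>] by auto
  moreover have "?t \<in> measurable (PiM {..<N} (\<lambda>_. M)) (borel :: (nat \<Rightarrow> real) measure)"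
  proof -
    have id: "(\<lambda>x. x) \<in> borel_measurable M"
      using sets by (simp add: measurable_ident_sets)
    have "?t \<in> measurable (PiM {..<N} (\<lambda>_. M)) (PiM UNIV (\<lambda>_. borel))"
    proof (rule measurable_PiM_single')
      fix i :: nat
      show "(\<lambda>\<theta>. ?t \<theta> i) \<in> borel_measurable (PiM {..<N} (\<lambda>_. M))"
        using measurable_compose[OF measurable_component_singleton[of i "{..<N}" "\<lambda>_. M"] id]
        by (cases "i < N") auto
    qed auto
    then show ?thesis
      using measurable_cong_sets[OF refl sets_PiM_equal_borel] by blast
  qed
  ultimately have "(\<lambda>\<theta>. ?g (?t \<theta>)) \<in> borel_measurable (PiM {..<N} (\<lambda>_. M))"
    by (rule measurable_compose[rotated])
  moreover have "vandermonde N (?t \<theta>) = vandermonde N \<theta>" for \<theta>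
    unfolding vandermonde_def by (intro cong_mat) auto
  ultimately show ?thesis by simp
qed

section \<open>Lower bound from a cluster of phases\<close>

text \<open>A chord is at most its arc: after factoring out \<open>cis y\<close> this is the Taylor
  remainder of order zero.\<close>

lemma norm_cis_diff_le: "cmod (cis x - cis y) \<le> \<bar>x - y\<bar>"
proof -
  have "cis x - cis y = cis y * (iexp (x - y) - 1)"
    by (simp add: cis_conv_exp algebra_simps flip: exp_add)
  then show ?thesis
    using iexp_approx1[of "x - y" 0] by (simp add: norm_mult)
qed

text \<open>The indicator of \<open>S\<close> has squared norm \<open>m = card S\<close>, while each
  of the \<open>N\<close> rows contributes at least \<open>m^2 * (1 - c)^2 / N\<close> to the
  form.\<close>

lemma max_eigenvalue_vandermonde_cluster:
  assumes "N > 0" and S: "S \<subseteq> {..<N}"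
    and near: "\<And>l. l \<in> S \<Longrightarrow> \<bar>\<theta> l - x\<bar> \<le> c / real N" and c: "c \<le> 1"
  shows "real (card S) * (1 - c)\<^sup>2 \<le> max_eigenvalue (vandermonde_gram N \<theta>)"
proof (cases "S = {}")
  case True
  let ?B = "vandermonde N \<theta>"
  obtain u where "gram_form N (\<lambda>k l. ?B $$ (k, l)) u = max_eigenvalue (vandermonde_gram N \<theta>)"
    using max_eigenvalue_gram(2)[OF vandermonde_carrier[of N \<theta>] assms(1)] by auto
  moreover have "0 \<le> gram_form N (\<lambda>k l. ?B $$ (k, l)) u" unfolding gram_form_def by (intro sum_nonneg) auto
  ultimately show ?thesis using True by simp
next
  case False
  define m where "m = real (card S)"
  have finS: "finite S" using S finite_subset by blast
  then have m: "m > 0" using False by (auto simp: m_def card_gt_0_iff)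
  define v :: "nat \<Rightarrow> complex" where "v = indicator S"
  have [simp]: "{..<N} \<inter> S = S" using S by auto
  have norm_v: "sq_norm_upto N v = m"
    using finS by (simp add: sq_norm_upto_def v_def m_def indicator_def if_distrib[of "\<lambda>x. (cmod x)\<^sup>2"] 
      sum.If_cases of_bool_def cong: if_cong)
  have row: "m\<^sup>2 * (1 - c)\<^sup>2 / real N
      \<le> (cmod (\<Sum>l<N. cis (- real k * \<theta> l) / complex_of_real (sqrt (real N)) * v l))\<^sup>2" if "k < N" for k
  proof -
    let ?s = "\<Sum>l\<in>S. cis (- real k * \<theta> l)"
    have "cmod (?s - of_real m * cis (- real k * x)) = cmod (\<Sum>l\<in>S. cis (- real k * \<theta> l) - cis (- real k * x))"
      by (simp add: sum_subtractf m_def)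
    \<comment> \<open>Since \<open>k < N\<close>, multiplying by \<open>k\<close> enlarges the
      distance \<open>c / N\<close> to at most \<open>c\<close>.\<close>
    also have "\<dots> \<le> (\<Sum>l\<in>S. c)"
    proof (intro order_trans[OF norm_sum] sum_mono)
      fix l assume "l \<in> S"
      have "cmod (cis (- real k * \<theta> l) - cis (- real k * x)) \<le> \<bar>- real k * \<theta> l - - real k * x\<bar>"
        by (rule norm_cis_diff_le)
      also have "\<dots> = real k * \<bar>\<theta> l - x\<bar>"
        by (simp add: abs_mult abs_minus_commute flip: right_diff_distrib)
      also have "\<dots> \<le> real N * (c / real N)"
        using near[OF \<open>l \<in> S\<close>] that by (intro mult_mono) auto
      finally show "cmod (cis (- real k * \<theta> l) - cis (- real k * x)) \<le> c" using \<open>N > 0\<close> by simp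
    qed
    finally have "m * (1 - c) \<le> cmod ?s"
      using norm_triangle_ineq2[of "of_real m * cis (- real k * x)" ?s] m
      by (simp add: norm_mult norm_minus_commute m_def algebra_simps)
    \<comment> \<open>The bound \<open>c \<le> 1\<close> makes the left side nonnegative before
      squaring.\<close>
    then have "(m * (1 - c))\<^sup>2 \<le> (cmod ?s)\<^sup>2" using m c by (intro power_mono) auto
    moreover have "(\<Sum>l<N. cis (- real k * \<theta> l) / complex_of_real (sqrt (real N)) * v l)
        = ?s / complex_of_real (sqrt (real N))"
      unfolding v_def indicator_def of_bool_def sum_divide_distrib
      using sum.inter_restrict[of "{..<N}" "\<lambda>l. cis (- real k * \<theta> l) / complex_of_real (sqrt (real N))" S]
      by (simp add: if_distrib cong: if_cong)
    ultimately show ?thesis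
      by (simp add: norm_divide power_divide power_mult_distrib divide_right_mono)
  qed
  have "m\<^sup>2 * (1 - c)\<^sup>2 = (\<Sum>k<N. m\<^sup>2 * (1 - c)\<^sup>2 / real N)" using \<open>N > 0\<close> by simp
  also have "\<dots> \<le> gram_form N (\<lambda>k l. vandermonde N \<theta> $$ (k, l)) v"
    unfolding gram_form_vandermonde by (intro sum_mono row) auto
  also have "\<dots> \<le> max_eigenvalue (vandermonde_gram N \<theta>) * m"
    using max_eigenvalue_gram(1)[OF vandermonde_carrier \<open>N > 0\<close>] norm_v by metis
  finally show ?thesis using m unfolding m_def[symmetric] by (simp add: power2_eq_square)
qed

section \<open>Asymptotics\<close>

text \<open>From \<open>N choose m \<ge> (N / m)^m\<close>; the powers of \<open>N\<close> cancel,
  which leaves an expression in \<open>m\<close> alone.\<close>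

lemma binomial_times_power_ge:
  assumes "0 < m" "m \<le> N" "\<gamma> > 0"
  shows "(\<gamma> / real m) ^ m \<le> real (N choose m) * (\<gamma> / real N) ^ m"
proof -
  have "(\<gamma> / real m) ^ m = (real N / real m) ^ m * (\<gamma> / real N) ^ m"
    using assms by (simp add: flip: power_mult_distrib)
  also have "\<dots> \<le> real (N choose m) * (\<gamma> / real N) ^ m"
    using assms by (intro mult_right_mono binomial_ge_n_over_k_pow_k) auto
  finally show ?thesis .
qed

text \<open>Eventually \<open>ln m \<le> ln (ln N)\<close>, so the logarithm is at least
  \<open>(1 - \<beta>) * ln N - o(ln N)\<close>. This is where \<open>\<beta> < 1\<close>
  enters.\<close>

lemma filterlim_n_times_power_at_top:
  fixes \<beta> \<gamma> :: real
  assumes \<beta>: "0 < \<beta>" "\<beta> < 1" and \<gamma>: "0 < \<gamma>"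
  defines "m \<equiv> \<lambda>N::nat. nat \<lceil>\<beta> * ln (real N) / ln (ln (real N))\<rceil>"
  shows "filterlim (\<lambda>N. real N * (\<gamma> / real (m N)) ^ m N) at_top sequentially"
proof (rule filterlim_at_top_mono)
  let ?x = "\<lambda>N::nat. \<beta> * ln (real N) / ln (ln (real N))"
  \<comment> \<open>\<open>D\<close> absorbs \<open>- ln \<gamma>\<close>, whatever its sign; the
    \<open>+ 1\<close> in \<open>?f\<close> pays for the ceiling in \<open>m\<close>.\<close>
  define D where "D = \<bar>ln \<gamma>\<bar>"
  let ?f = "\<lambda>N::nat. ln (real N) - (?x N + 1) * (ln (ln (real N)) + D)"
  have "filterlim ?f at_top sequentially"
    using \<beta> by real_asymp
  then show "filterlim (\<lambda>N. exp (?f N)) at_top sequentially"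
    by (rule filterlim_compose[OF exp_at_top])
  have "eventually (\<lambda>N. ?x N > 0) sequentially" using \<beta> by real_asymp
  moreover have "eventually (\<lambda>N. ?x N + 1 \<le> ln (real N)) sequentially" using \<beta> by real_asymp
  moreover have "eventually (\<lambda>N::nat. N > 0) sequentially" by real_asymp
  ultimately show "eventually (\<lambda>N. exp (?f N) \<le> real N * (\<gamma> / real (m N)) ^ m N) sequentially"
  proof eventually_elim
    case (elim N)
    have m: "0 < m N" "real (m N) \<le> ?x N + 1"
      using elim unfolding m_def by linarith+
    have "ln (real (m N)) \<le> ln (ln (real N))"
      using m elim by (intro ln_mono) auto
    then have "real (m N) * (ln (real (m N)) - ln \<gamma>) \<le> real (m N) * (ln (ln (real N)) + D)"
      unfolding D_def by (intro mult_left_mono) linarith+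
    also have "\<dots> \<le> (?x N + 1) * (ln (ln (real N)) + D)"
      using m elim by (intro mult_right_mono add_nonneg_nonneg) (auto simp: D_def)
    finally have "exp (?f N) \<le> exp (ln (real N) + real (m N) * ln (\<gamma> / real (m N)))"
      using m \<gamma> by (simp add: ln_div algebra_simps)
    also have "\<dots> = real N * (\<gamma> / real (m N)) ^ m N"
      using m \<gamma> elim by (simp add: exp_add exp_of_nat_mult)
    finally show ?case .
  qed
qed

text \<open>This is the error of \<open>exists_full_bin\<close> for bin masses between
  \<open>\<gamma> / N\<close> and \<open>\<Gamma> / N\<close>. In the first term
  \<open>(1 - \<Gamma> / N)^N\<close> tends to \<open>exp (- \<Gamma>)\<close>, so the growth of
  \<open>N * (\<gamma> / m)^m\<close> decides; the second vanishes because \<open>m / N\<close>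
  tends to 0.\<close>

lemma occupancy_error_tendsto_0:
  fixes \<beta> \<gamma> \<Gamma> \<kappa> :: real and K :: "nat \<Rightarrow> nat"
  assumes \<beta>: "0 < \<beta>" "\<beta> < 1" and \<gamma>: "0 < \<gamma>" and \<Gamma>: "0 \<le> \<Gamma>" and \<kappa>: "0 < \<kappa>"
    and K: "eventually (\<lambda>N. \<kappa> * real N \<le> real (K N)) sequentially"
  defines "m \<equiv> \<lambda>N::nat. nat \<lceil>\<beta> * ln (real N) / ln (ln (real N))\<rceil>"
  shows "(\<lambda>N. 1 / (real (K N) * real (N choose m N) * (\<gamma> / real N) ^ m N * (1 - \<Gamma> / real N) ^ N)
      + ((1 / (1 - \<Gamma> / real N)) ^ (2 * m N) - 1)) \<longlonglongrightarrow> 0"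
proof -
  let ?x = "\<lambda>N::nat. \<beta> * ln (real N) / ln (ln (real N))"
  have ev: "eventually (\<lambda>N. ?x N > 0) sequentially" "eventually (\<lambda>N::nat. ?x N + 1 \<le> real N) sequentially"
    "eventually (\<lambda>N::nat. \<Gamma> < real N) sequentially"
    using \<beta> by real_asymp+
  have m: "eventually (\<lambda>N. 0 < m N \<and> m N \<le> N \<and> real (m N) \<le> ?x N + 1) sequentially"
    using ev(1,2)
  proof eventually_elim
    case (elim N)
    then have "0 < m N" "real (m N) \<le> ?x N + 1" unfolding m_def by linarith+
    then show ?case using elim by linarith
  qed
  have "(\<lambda>N. (1 - \<Gamma> / real N) ^ N) \<longlonglongrightarrow> exp (- \<Gamma>)"
    using tendsto_exp_limit_sequentially[of "- \<Gamma>"] by simp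
  then have "filterlim (\<lambda>N. \<kappa> * (1 - \<Gamma> / real N) ^ N * (real N * (\<gamma> / real (m N)) ^ m N)) at_top sequentially"
    unfolding m_def using \<kappa> filterlim_n_times_power_at_top[OF \<beta> \<gamma>]
    by (intro filterlim_tendsto_pos_mult_at_top[OF tendsto_mult[OF tendsto_const]]) auto
  then have mu: "filterlim (\<lambda>N. real (K N) * real (N choose m N) * (\<gamma> / real N) ^ m N * (1 - \<Gamma> / real N) ^ N)
      at_top sequentially"
  proof (rule filterlim_at_top_mono)
    show "eventually (\<lambda>N. \<kappa> * (1 - \<Gamma> / real N) ^ N * (real N * (\<gamma> / real (m N)) ^ m N)
        \<le> real (K N) * real (N choose m N) * (\<gamma> / real N) ^ m N * (1 - \<Gamma> / real N) ^ N) sequentially"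
      using m ev(3) K
    proof eventually_elim
      case (elim N)
      have "(\<kappa> * real N) * (\<gamma> / real (m N)) ^ m N \<le> real (K N) * (real (N choose m N) * (\<gamma> / real N) ^ m N)"
        using elim \<gamma> \<kappa> binomial_times_power_ge[of "m N" N \<gamma>] by (intro mult_mono) auto
      moreover have "0 \<le> (1 - \<Gamma> / real N) ^ N" using elim \<Gamma> by simp
      ultimately have "(\<kappa> * real N) * (\<gamma> / real (m N)) ^ m N * (1 - \<Gamma> / real N) ^ N
          \<le> real (K N) * (real (N choose m N) * (\<gamma> / real N) ^ m N) * (1 - \<Gamma> / real N) ^ N"
        by (rule mult_right_mono)
      then show ?case by (simp add: mult_ac)
    qed
  qed
  have "(\<lambda>N. (1 - \<Gamma> / real N) ^ (2 * m N)) \<longlonglongrightarrow> 1"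
  proof (rule tendsto_sandwich)
    \<comment> \<open>The lower envelope comes from Bernoulli's inequality and
      \<open>m \<le> ?x N + 1\<close>.\<close>
    show "(\<lambda>N. 1 - 2 * (?x N + 1) * \<Gamma> / real N) \<longlonglongrightarrow> 1"
      using \<beta> by real_asymp
    show "eventually (\<lambda>N. 1 - 2 * (?x N + 1) * \<Gamma> / real N \<le> (1 - \<Gamma> / real N) ^ (2 * m N)) sequentially"
      using m ev(3)
    proof eventually_elim
      case (elim N)
      have "2 * real (m N) * (\<Gamma> / real N) \<le> 2 * (?x N + 1) * (\<Gamma> / real N)"
        using elim \<Gamma> by (intro mult_right_mono) auto
      moreover have "1 + real (2 * m N) * (- (\<Gamma> / real N)) \<le> (1 + - (\<Gamma> / real N)) ^ (2 * m N)"
        using elim \<Gamma> by (intro Bernoulli_inequality) auto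
      ultimately show ?case by simp
    qed
    show "eventually (\<lambda>N. (1 - \<Gamma> / real N) ^ (2 * m N) \<le> 1) sequentially"
      using ev(3) by eventually_elim (use \<Gamma> in \<open>auto intro!: power_le_one\<close>)
  qed auto
  from tendsto_add[OF tendsto_divide_0[OF tendsto_const filterlim_at_top_imp_at_infinity[OF mu]]
      tendsto_diff[OF tendsto_divide[OF tendsto_const this] tendsto_const], of 1 1 1]
  show ?thesis by (simp add: power_divide)
qed

section \<open>Bin masses under a continuous density\<close>

lemma continuous_density_bounds:
  fixes p :: "real \<Rightarrow> real"
  assumes cont: "continuous_on {u..v} p" and "u < v"
    and x0: "x0 \<in> {u..v}" "p x0 > 0"
  obtains a b where "u \<le> a" "a < b" "b \<le> v" "\<And>x. x \<in> {a..b} \<Longrightarrow> p x0 / 2 \<le> p x \<and> p x \<le> 2 * p x0"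
proof -
  obtain d where d: "d > 0" "\<And>x. x \<in> {u..v} \<Longrightarrow> dist x x0 < d \<Longrightarrow> dist (p x) (p x0) < p x0 / 2"
    using cont x0 unfolding continuous_on_iff by (metis half_gt_zero)
  \<comment> \<open>The point \<open>x0\<close> may be an end of \<open>{u..v}\<close>, hence the
    clipping; \<open>d / 2\<close> keeps the closed interval inside the open
    \<open>d\<close>-ball.\<close>
  define a where "a = max u (x0 - d / 2)"
  define b where "b = min v (x0 + d / 2)"
  have "u \<le> a" "a < b" "b \<le> v" using d(1) x0 \<open>u < v\<close> by (auto simp: a_def b_def)
  moreover have "p x0 / 2 \<le> p x \<and> p x \<le> 2 * p x0" if "x \<in> {a..b}" for x
  proof -
    have "x \<in> {u..v}" "dist x x0 < d"
      using that d(1) by (auto simp: a_def b_def dist_real_def)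
    from d(2)[OF this] show ?thesis unfolding dist_real_def using x0(2) by linarith
  qed
  ultimately show thesis by (rule that)
qed

text \<open>The density is compared with constants under the integral. The interval is half-open so
  that adjacent bins will be disjoint.\<close>

lemma measure_density_interval_bounds:
  fixes f :: "real \<Rightarrow> real" and s t \<delta> \<Delta> :: real
  assumes M: "M = density lborel (\<lambda>x. ennreal (f x))" "prob_space M" and f: "f \<in> borel_measurable borel"
    and "s \<le> t" "0 \<le> \<delta>" "0 \<le> \<Delta>" and bounds: "\<And>x. x \<in> {s..<t} \<Longrightarrow> \<delta> \<le> f x \<and> f x \<le> \<Delta>"
  shows "\<delta> * (t - s) \<le> measure M {s..<t}" "measure M {s..<t} \<le> \<Delta> * (t - s)"
proof -
  interpret prob_space M by fact
  have eq: "emeasure M {s..<t} = (\<integral>\<^sup>+x. ennreal (f x) * indicator {s..<t} x \<partial>lborel)"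
    unfolding M(1) using f by (subst emeasure_density) auto
  have const: "(\<integral>\<^sup>+x. ennreal c * indicator {s..<t} x \<partial>lborel) = ennreal (c * (t - s))" if "0 \<le> c" for c
    using that \<open>s \<le> t\<close> by (simp add: nn_integral_cmult_indicator ennreal_mult)
  have "ennreal (\<delta> * (t - s)) \<le> emeasure M {s..<t}"
    unfolding eq const[OF \<open>0 \<le> \<delta>\<close>, symmetric] using bounds
    by (intro nn_integral_mono) (auto simp: indicator_def ennreal_leI)
  moreover have "emeasure M {s..<t} \<le> ennreal (\<Delta> * (t - s))"
    unfolding eq const[OF \<open>0 \<le> \<Delta>\<close>, symmetric] using bounds
    by (intro nn_integral_mono) (auto simp: indicator_def ennreal_leI)
  ultimately show "\<delta> * (t - s) \<le> measure M {s..<t}" "measure M {s..<t} \<le> \<Delta> * (t - s)"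
    using \<open>s \<le> t\<close> \<open>0 \<le> \<Delta>\<close> by (simp_all add: emeasure_eq_measure)
qed

theorem theorem6:
  fixes p :: "real \<Rightarrow> real" and \<nu> :: "real measure" and \<alpha> :: real
  assumes p_nonneg: "\<And>x. x \<in> {-pi..pi} \<Longrightarrow> p x \<ge> 0"
    and p_cont: "continuous_on {-pi..pi} p"
    and nu_def: "\<nu> = density lborel (\<lambda>x. ennreal (p x * indicator {-pi..pi} x))"
    and nu_prob: "prob_space \<nu>"
    and alpha: "0 < \<alpha>" "\<alpha> < 1"
  shows "(\<lambda>N. measure (PiM {..<N} (\<lambda>_. \<nu>))
            {\<theta> \<in> space (PiM {..<N} (\<lambda>_. \<nu>)).
               max_eigenvalue (mat_adjoint (vandermonde N \<theta>) * vandermonde N \<theta>)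
                 \<ge> \<alpha> * ln (real N) / ln (ln (real N))})
         \<longlonglongrightarrow> 1"
proof -
  interpret nu: prob_space \<nu> by (rule nu_prob)
  define f where "f x = p x * indicator {-pi..pi} x" for x
  have f_meas: "f \<in> borel_measurable borel"
    using borel_measurable_continuous_on_indicator[OF _ p_cont] by (simp add: f_def[abs_def] mult.commute)
  have nu_f: "\<nu> = density lborel (\<lambda>x. ennreal (f x))" by (simp add: nu_def f_def)
  have sets_nu: "sets \<nu> = sets borel" by (simp add: nu_def)
  obtain x0 where x0: "x0 \<in> {-pi..pi}" "p x0 > 0"
  proof -
    \<comment> \<open>A density vanishing on all of \<open>{-pi..pi}\<close> would give total mass
      0.\<close>
    have "\<exists>x\<in>{-pi..pi}. p x \<noteq> 0"
    proof (rule ccontr)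
      assume "\<not> ?thesis"
      then have "f = (\<lambda>_. 0)" by (auto simp: fun_eq_iff f_def indicator_def)
      then have "emeasure \<nu> (space \<nu>) = 0" unfolding nu_f by (simp add: emeasure_density)
      then show False using nu.emeasure_space_1 by simp
    qed
    then show thesis using that p_nonneg by (metis order_le_less)
  qed
  have "- pi < pi" using pi_gt_zero by linarith
  then obtain a b where ab: "-pi \<le> a" "a < b" "b \<le> pi"
    and p_ab: "\<And>x. x \<in> {a..b} \<Longrightarrow> p x0 / 2 \<le> p x \<and> p x \<le> 2 * p x0"
    using continuous_density_bounds[OF p_cont _ x0] by metis
  define \<beta> where "\<beta> = (1 + \<alpha>) / 2"
  have \<beta>: "0 < \<beta>" "\<beta> < 1" "\<alpha> < \<beta>" using alpha by (auto simp: \<beta>_def)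
  define c where "c = 1 - sqrt (\<alpha> / \<beta>)"
  have c: "0 < c" "c \<le> 1" "(1 - c)\<^sup>2 = \<alpha> / \<beta>" using alpha \<beta> by (auto simp: c_def)
  define m where "m N = nat \<lceil>\<beta> * ln (real N) / ln (ln (real N))\<rceil>" for N :: nat
  \<comment> \<open>The number of whole bins of length \<open>c / N\<close> that fit into
    \<open>[a, b]\<close>.\<close>
  define K where "K N = nat \<lfloor>(b - a) / c * real N\<rfloor>" for N
  define \<gamma> where "\<gamma> = p x0 / 2 * c"
  define \<Gamma> where "\<Gamma> = 2 * p x0 * c"
  \<comment> \<open>Half the ratio of \<open>K N\<close> to \<open>N\<close> before rounding: once
    \<open>\<kappa> * N \<ge> 1\<close>, the other half covers the loss from the floor.\<close>
  define \<kappa> where "\<kappa> = (b - a) / c / 2"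
  have pos: "\<gamma> > 0" "\<Gamma> > 0" "\<kappa> > 0" using x0 c ab by (auto simp: \<gamma>_def \<Gamma>_def \<kappa>_def)
  have "eventually (\<lambda>N::nat. 1 \<le> \<kappa> * real N) sequentially" using pos by real_asymp
  then have K: "eventually (\<lambda>N. \<kappa> * real N \<le> real (K N) \<and> 0 < K N) sequentially"
  proof eventually_elim
    case (elim N)
    have "(b - a) / c * real N = 2 * (\<kappa> * real N)" by (simp add: \<kappa>_def)
    then show ?case using elim unfolding K_def by linarith
  qed
  let ?P = "\<lambda>N. PiM {..<N} (\<lambda>_. \<nu>)"
  let ?G = "\<lambda>N. {\<theta> \<in> space (?P N). max_eigenvalue (vandermonde_gram N \<theta>) \<ge> \<alpha> * ln (real N) / ln (ln (real N))}"
  define err where "err N = 1 / (real (K N) * real (N choose m N) * (\<gamma> / real N) ^ m N * (1 - \<Gamma> / real N) ^ N)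
      + ((1 / (1 - \<Gamma> / real N)) ^ (2 * m N) - 1)" for N
  have "err \<longlonglongrightarrow> 0"
    unfolding err_def m_def
    by (rule occupancy_error_tendsto_0[OF \<beta>(1,2) pos(1) _ pos(3)])
      (use pos K in \<open>auto elim: eventually_mono\<close>)
  have "eventually (\<lambda>N::nat. \<beta> * ln (real N) / ln (ln (real N)) + 1 \<le> real N) sequentially"
    using \<beta> by real_asymp
  moreover have "eventually (\<lambda>N::nat. 0 \<le> \<beta> * ln (real N) / ln (ln (real N))) sequentially"
    using \<beta> by real_asymp
  moreover have "eventually (\<lambda>N::nat. \<Gamma> < real N) sequentially" by real_asymp
  ultimately have lower: "eventually (\<lambda>N. 1 - err N \<le> measure (?P N) (?G N)) sequentially"
    using K
  proof eventually_elim
    case (elim N)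
    have "N > 0" using elim(3) pos(2) by (cases N) auto
    have m: "m N \<le> N" "\<beta> * ln (real N) / ln (ln (real N)) \<le> real (m N)"
      using elim(1,2) unfolding m_def by linarith+
    define h where "h = c / real N"
    have h: "h > 0" using c \<open>N > 0\<close> by (simp add: h_def)
    define B where "B i = {a + real i * h..<a + real (Suc i) * h}" for i
    have bounds: "\<gamma> / real N \<le> measure \<nu> (B i) \<and> measure \<nu> (B i) \<le> \<Gamma> / real N" if "i < K N" for i
    proof -
      \<comment> \<open>The floor in \<open>K\<close> keeps even the last bin inside
        \<open>[a, b]\<close>, where the density bounds hold.\<close>
      have "real (Suc i) \<le> real (K N)" using that by simp
      also have "\<dots> \<le> (b - a) / c * real N" 
        using ab c unfolding K_def by simp
      also have "\<dots> = (b - a) / h" using c by (simp add: h_def)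
      finally have "real (Suc i) * h \<le> b - a" using h by (simp add: field_simps)
      moreover have "0 \<le> real i * h" using h by simp
      ultimately have sub: "B i \<subseteq> {a..b}" unfolding B_def by auto
      have f: "p x0 / 2 \<le> f x \<and> f x \<le> 2 * p x0" if "x \<in> B i" for x
        using p_ab[of x] sub that ab by (auto simp: f_def indicator_def subset_iff)
      have len: "a + real (Suc i) * h - (a + real i * h) = h" by (simp add: algebra_simps)
      have le: "a + real i * h \<le> a + real (Suc i) * h" using h by (simp add: algebra_simps)
      have eq: "\<gamma> / real N = p x0 / 2 * h" "\<Gamma> / real N = 2 * p x0 * h"
        by (simp_all add: \<gamma>_def \<Gamma>_def h_def)
      have "0 \<le> p x0 / 2" "0 \<le> 2 * p x0" using x0 by auto
      from measure_density_interval_bounds[OF nu_f nu_prob f_meas le this f[unfolded B_def]]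
      show ?thesis unfolding len B_def eq by blast
    qed
    have B_sets: "B i \<in> sets \<nu>" for i
      by (simp add: B_def sets_nu)
    have disj: "disjoint_family_on B {..<K N}"
    proof -
      have "B i \<inter> B j = {}" if "i < j" for i j
      proof -
        have "real (Suc i) * h \<le> real j * h" using that h by (intro mult_right_mono) auto
        then show ?thesis by (auto simp: B_def)
      qed
      then show ?thesis
        unfolding disjoint_family_on_def by (metis Int_commute linorder_neqE_nat)
    qed
    \<comment> \<open>Here \<open>q = \<gamma> / N\<close> and \<open>Q = \<Gamma> / N\<close>; the
      condition \<open>\<Gamma> < N\<close> gives \<open>Q < 1\<close>.\<close>
    have "\<exists>E\<in>sets (?P N). (\<forall>\<theta>\<in>E. \<exists>i<K N. \<exists>S\<subseteq>{..<N}. card S = m N \<and> (\<forall>l\<in>S. \<theta> l \<in> B i)) \<and>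
        1 - err N \<le> measure (?P N) E"
      unfolding err_def
      by (rule nu.exists_full_bin)
        (use disj bounds elim m(1) pos \<open>N > 0\<close> in \<open>simp_all add: B_sets\<close>)
    then obtain E where E: "E \<in> sets (?P N)"
      "\<And>\<theta>. \<theta> \<in> E \<Longrightarrow> \<exists>i<K N. \<exists>S\<subseteq>{..<N}. card S = m N \<and> (\<forall>l\<in>S. \<theta> l \<in> B i)"
      "1 - err N \<le> measure (?P N) E"
      by (elim bexE conjE) simp
    have "E \<subseteq> ?G N"
    proof
      fix \<theta> assume "\<theta> \<in> E"
      from E(2)[OF this] obtain i S
        where S: "S \<subseteq> {..<N}" "card S = m N" "\<forall>l\<in>S. \<theta> l \<in> B i"
        by (elim exE conjE)
      have "\<alpha> * ln (real N) / ln (ln (real N)) = \<beta> * ln (real N) / ln (ln (real N)) * (1 - c)\<^sup>2"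
        using \<beta> unfolding c(3) by simp
      also have "\<dots> \<le> real (m N) * (1 - c)\<^sup>2"
        using m(2) by (intro mult_right_mono) auto
      also have "\<dots> \<le> max_eigenvalue (vandermonde_gram N \<theta>)"
        unfolding S(2)[symmetric]
      proof (rule max_eigenvalue_vandermonde_cluster[OF \<open>N > 0\<close> S(1) _ c(2)])
        fix l assume "l \<in> S"
        from bspec[OF S(3) this] show "\<bar>\<theta> l - (a + real i * h)\<bar> \<le> c / real N"
          unfolding h_def[symmetric] B_def by (auto simp: algebra_simps)
      qed
      finally show "\<theta> \<in> ?G N"
        using sets.sets_into_space[OF E(1)] \<open>\<theta> \<in> E\<close> by auto
    qed
    \<comment> \<open>Monotonicity needs this: \<open>measure\<close> is 0 on nonmeasurable sets, so
      \<open>E \<subseteq> ?G N\<close> alone would bound nothing.\<close>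
    moreover have "?G N \<in> sets (?P N)"
      using borel_measurable_max_eigenvalue_vandermonde[OF \<open>N > 0\<close> sets_nu] by measurable
    moreover have "prob_space (?P N)" by (intro prob_space_PiM nu_prob)
    ultimately show ?case
      using E(1,3) by (meson finite_measure.finite_measure_mono order_trans prob_space_def)
  qed
  show ?thesis
  proof (rule tendsto_sandwich[OF lower])
    show "(\<lambda>N. 1 - err N) \<longlonglongrightarrow> 1"
      using tendsto_diff[OF tendsto_const \<open>err \<longlonglongrightarrow> 0\<close>, of 1] by simp
    show "eventually (\<lambda>N. measure (?P N) (?G N) \<le> 1) sequentially"
      by (intro always_eventually allI prob_space.prob_le_1 prob_space_PiM nu_prob)
  qed auto
qed

end
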